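(* Let $A\in\mathbb{R}^{m\times n}$ and $H\in\mathbb{R}^{n\times m}$. Then $H$ satisfies all three of the conditions $AHA=A$, $HAH=H$, and $(AH)^\top = AH$ (i.e., $H$ is an ah-symmetric reflexive generalized inverse of $A$) if and only if $$A^\top H^\top A^\top + H A A^\dagger = A^\top + H .$$
   Context: $A^\dagger\in\mathbb{R}^{n\times m}$ denotes the Moore-Penrose pseudoinverse of $A$. $H$ is a generalized inverse of $A$ if $AHA=A$; it is reflexive if $HAH=H$; it is ah-symmetric if $AH$ is symmetric. *)

theory Defs
  imports "HOL-Analysis.Analysis"
begin

text \<open>A matrix with m rows and n columns has type \<open>real ^ 'n ^ 'm\<close>, so for
  \<open>A :: real ^ 'n ^ 'm\<close> a candidate inverse has type \<open>real ^ 'm ^ 'n\<close>.\<close>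

definition generalized_inverse :: "real ^ 'n ^ 'm \<Rightarrow> real ^ 'm ^ 'n \<Rightarrow> bool" where
  "generalized_inverse A H \<longleftrightarrow> A ** H ** A = A"

definition reflexive_inverse :: "real ^ 'n ^ 'm \<Rightarrow> real ^ 'm ^ 'n \<Rightarrow> bool" where
  "reflexive_inverse A H \<longleftrightarrow> H ** A ** H = H"

definition ah_symmetric :: "real ^ 'n ^ 'm \<Rightarrow> real ^ 'm ^ 'n \<Rightarrow> bool" where
  "ah_symmetric A H \<longleftrightarrow> transpose (A ** H) = A ** H"

text \<open>The Moore-Penrose pseudoinverse is the matrix singled out by the four Penrose
  equations; every real matrix has exactly one such matrix, so the description below
  always denotes.\<close>

definition is_pseudoinverse :: "real ^ 'n ^ 'm \<Rightarrow> real ^ 'm ^ 'n \<Rightarrow> bool" where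
  "is_pseudoinverse A X \<longleftrightarrow>
     A ** X ** A = A \<and> X ** A ** X = X \<and>
     transpose (A ** X) = A ** X \<and> transpose (X ** A) = X ** A"

definition pseudoinverse :: "real ^ 'n ^ 'm \<Rightarrow> real ^ 'm ^ 'n" where
  "pseudoinverse A = (THE X. is_pseudoinverse A X)"

end

theory Submission
  imports Defs
begin

text \<open>
  If \<open>G\<close> is any generalized inverse of \<open>A\<close> for which \<open>A ** G\<close> is symmetric, then \<open>A ** G\<close> is the
  orthogonal projector onto the column space of \<open>A\<close>, whichever \<open>G\<close> was chosen
  (\<open>ah_symmetric_projector_unique\<close>). The pseudoinverse \<open>P\<close> is one such \<open>G\<close>. Hence an ah-symmetric
  reflexive generalized inverse \<open>H\<close> has \<open>A ** H = A ** P\<close>, which turns \<open>H ** A ** H = H\<close> into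
  \<open>H ** A ** P = H\<close>, while the transpose of \<open>A ** H ** A = A\<close> gives the other half of the equation.

  Conversely, the single equation splits into these two halves: multiplying it on the right by the
  projector \<open>A ** P\<close> leaves the two summands ending in \<open>transpose A\<close> and the summand
  \<open>H ** A ** P\<close> unchanged and turns \<open>H\<close> into \<open>H ** A ** P\<close>; these last terms cancel, and
  \<open>A ** H ** A = A\<close> remains. What is left of the equation is \<open>H ** A ** P = H\<close>, and then
  \<open>A ** H = A ** H ** A ** P = A ** P\<close> is symmetric.

  The argument uses the Penrose equations for \<open>pseudoinverse A\<close>, so the definite description has to
  be shown to denote. Existence rests on the solvability of the normal equations, that is, on
  orthogonal projection onto the column space.
\<close>

section \<open>Inverses with a symmetric projector\<close>

text \<open>Both products fix the column space, so \<open>A ** X = (A ** Y) ** (A ** X)\<close>; transposing reverses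
  the order of the two symmetric factors, and the product collapses to \<open>A ** Y\<close>.\<close>

lemma ah_symmetric_projector_unique:
  fixes A :: "real ^ 'n ^ 'm"
  assumes "generalized_inverse A X" "ah_symmetric A X"
    and "generalized_inverse A Y" "ah_symmetric A Y"
  shows "A ** X = A ** Y"
proof -
  have "A ** X = (A ** Y) ** (A ** X)"
    using assms(3) by (metis generalized_inverse_def matrix_mul_assoc)
  then have "transpose (A ** X) = transpose (A ** X) ** transpose (A ** Y)"
    by (metis matrix_transpose_mul)
  then have "A ** X = (A ** X) ** (A ** Y)"
    using assms(2,4) by (simp add: ah_symmetric_def)
  also have "\<dots> = A ** Y"
    using assms(1) by (metis generalized_inverse_def matrix_mul_assoc)
  finally show ?thesis .
qed

text \<open>The residual of the orthogonal projection of \<open>y\<close> onto the column space of \<open>A\<close> is orthogonal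
  to every column, hence is annihilated by \<open>transpose A\<close>.\<close>

lemma normal_equations_solvable:
  fixes A :: "real ^ 'n ^ 'm" and y :: "real ^ 'm"
  shows "\<exists>x. (transpose A ** A) *v x = transpose A *v y"
proof -
  have span: "span (range ((*v) A)) = range ((*v) A)"
    by (intro span_eq_iff[THEN iffD2] linear_subspace_image subspace_UNIV
        matrix_vector_mul_linear)
  obtain p z where p: "p \<in> range ((*v) A)" and y: "y = p + z"
    and orth: "\<And>w. w \<in> range ((*v) A) \<Longrightarrow> orthogonal z w"
    using orthogonal_subspace_decomp_exists[of "range ((*v) A)" y] unfolding span by metis
  obtain x where x: "p = A *v x" using p by blast
  have "(transpose A *v z) \<bullet> w = 0" for w
    using orth[of "A *v w"] by (simp add: orthogonal_def dot_lmul_matrix)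
  then have "transpose A *v z = 0" by (metis inner_eq_zero_iff)
  then have "(transpose A ** A) *v x = transpose A *v y"
    by (simp add: y x matrix_vector_right_distrib matrix_vector_mul_assoc)
  then show ?thesis ..
qed

text \<open>Solving the normal equations for every unit vector gives a matrix \<open>G\<close> with
  \<open>transpose A ** A ** G = transpose A\<close>. This one equation already encodes both properties:
  \<open>transpose (A ** G)\<close> equals the Gram matrix \<open>transpose (A ** G) ** (A ** G)\<close>.\<close>

lemma ah_symmetric_generalized_inverse_exists:
  fixes A :: "real ^ 'n ^ 'm"
  shows "\<exists>G. generalized_inverse A G \<and> ah_symmetric A G"
proof -
  have "\<forall>j. \<exists>x. (transpose A ** A) *v x = column j (transpose A)"
    using normal_equations_solvable[of A] by (metis matrix_vector_mult_basis)
  then obtain g where g: "\<And>j. (transpose A ** A) *v g j = column j (transpose A)"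
    by metis
  define G :: "real ^ 'm ^ 'n" where "G = (\<chi> i j. g j $ i)"
  have "((transpose A ** A) ** G) $ i $ j = ((transpose A ** A) *v g j) $ i" for i j
    by (simp add: G_def matrix_matrix_mult_def[of "transpose A ** A"] matrix_vector_mult_def)
  then have "transpose A ** A ** G = transpose A"
    by (simp add: vec_eq_iff g column_def)
  then have normal: "transpose A ** (A ** G) = transpose A"
    by (simp add: matrix_mul_assoc)
  have gram: "transpose (A ** G) ** (A ** G) = transpose (A ** G)"
    by (metis normal matrix_mul_assoc matrix_transpose_mul)
  then have sym: "transpose (A ** G) = A ** G"
    by (metis matrix_transpose_mul transpose_transpose)
  have "A ** G ** A = A"
    by (metis normal sym matrix_transpose_mul transpose_transpose)
  with sym show ?thesis
    by (auto simp: generalized_inverse_def ah_symmetric_def)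
qed

section \<open>The Moore-Penrose pseudoinverse\<close>

text \<open>If \<open>A ** G\<close> is the orthogonal projector onto the column space and \<open>K ** A\<close> the one onto the
  row space, then \<open>K ** A ** G\<close> has both, and sandwiching \<open>A\<close> makes it reflexive. The matrix
  \<open>K\<close> comes from the existence of \<open>G\<close>, applied to \<open>transpose A\<close>.\<close>

lemma is_pseudoinverse_exists:
  fixes A :: "real ^ 'n ^ 'm"
  shows "\<exists>X. is_pseudoinverse A X"
proof -
  obtain G where G: "A ** G ** A = A" "transpose (A ** G) = A ** G"
    using ah_symmetric_generalized_inverse_exists[of A]
    by (auto simp: generalized_inverse_def ah_symmetric_def)
  obtain L where L: "transpose A ** L ** transpose A = transpose A"
      "transpose (transpose A ** L) = transpose A ** L"
    using ah_symmetric_generalized_inverse_exists[of "transpose A"]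
    by (auto simp: generalized_inverse_def ah_symmetric_def)
  define K where "K = transpose L"
  have K: "A ** K ** A = A" "transpose (K ** A) = K ** A"
    using L unfolding K_def
    by (metis matrix_mul_assoc matrix_transpose_mul transpose_transpose)+
  define X where "X = K ** A ** G"
  have AX: "A ** X = A ** G"
    using K(1) by (metis X_def matrix_mul_assoc)
  have XA: "X ** A = K ** A"
    using G(1) by (metis X_def matrix_mul_assoc)
  have "X ** A ** X = X"
    using K(1) by (metis XA X_def matrix_mul_assoc)
  then have "is_pseudoinverse A X"
    by (simp add: is_pseudoinverse_def AX XA G K)
  then show ?thesis ..
qed

text \<open>A pseudoinverse is determined by the projectors \<open>A ** X\<close> and \<open>X ** A\<close>, because
  \<open>X = X ** A ** X\<close>. Uniqueness of the second is uniqueness of the first for \<open>transpose A\<close>.\<close>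

lemma is_pseudoinverse_unique:
  fixes A :: "real ^ 'n ^ 'm"
  assumes "is_pseudoinverse A X" "is_pseudoinverse A Y"
  shows "X = Y"
proof -
  have left: "A ** X = A ** Y"
    using assms by (intro ah_symmetric_projector_unique)
      (auto simp: is_pseudoinverse_def generalized_inverse_def ah_symmetric_def)
  have transposed: "generalized_inverse (transpose A) (transpose Z)"
      "ah_symmetric (transpose A) (transpose Z)" if "is_pseudoinverse A Z" for Z
    using that unfolding is_pseudoinverse_def generalized_inverse_def ah_symmetric_def
    by (metis matrix_mul_assoc matrix_transpose_mul)+
  have "transpose A ** transpose X = transpose A ** transpose Y"
    using assms by (intro ah_symmetric_projector_unique transposed)
  then have right: "X ** A = Y ** A"
    by (metis matrix_transpose_mul transpose_transpose)
  have "X = X ** A ** X" "Y ** A ** Y = Y"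
    using assms by (simp_all add: is_pseudoinverse_def)
  then show ?thesis by (metis left right matrix_mul_assoc)
qed

lemma is_pseudoinverse_pseudoinverse: "is_pseudoinverse A (pseudoinverse A)"
  unfolding pseudoinverse_def
  using is_pseudoinverse_exists[of A] is_pseudoinverse_unique[of A] by (auto intro: theI)

lemma matrix_add_rdistrib:
  fixes B C :: "'a::semiring_1 ^ 'n ^ 'm"
  shows "(B + C) ** D = B ** D + C ** D"
  by (simp add: matrix_matrix_mult_def vec_eq_iff sum.distrib distrib_right)

section \<open>The characterization by one equation\<close>

theorem theorem9:
  fixes A :: "real ^ 'n ^ 'm" and H :: "real ^ 'm ^ 'n"
  shows "generalized_inverse A H \<and> reflexive_inverse A H \<and> ah_symmetric A H \<longleftrightarrow>
    transpose A ** transpose H ** transpose A + H ** A ** pseudoinverse A = transpose A + H"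
proof -
  define P where "P = pseudoinverse A"
  have P: "A ** P ** A = A" "transpose (A ** P) = A ** P"
    using is_pseudoinverse_pseudoinverse[of A] by (auto simp: is_pseudoinverse_def P_def)
  have transpose_AHA: "transpose A ** transpose H ** transpose A = transpose (A ** H ** A)"
    by (simp add: matrix_transpose_mul matrix_mul_assoc)
  show ?thesis unfolding P_def[symmetric] transpose_AHA
  proof
    assume H: "generalized_inverse A H \<and> reflexive_inverse A H \<and> ah_symmetric A H"
    then have "A ** H = A ** P"
      using P by (intro ah_symmetric_projector_unique)
        (auto simp: generalized_inverse_def ah_symmetric_def)
    then have "H ** A ** P = H"
      using H by (metis reflexive_inverse_def matrix_mul_assoc)
    then show "transpose (A ** H ** A) + H ** A ** P = transpose A + H"
      using H by (simp add: generalized_inverse_def)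
  next
    assume eq: "transpose (A ** H ** A) + H ** A ** P = transpose A + H"
    have absorb: "transpose (A ** B) ** (A ** P) = transpose (A ** B)" for B :: "real ^ 'n ^ 'n"
    proof -
      have "transpose (A ** B) ** (A ** P) = transpose (A ** P ** (A ** B))"
        by (simp add: matrix_transpose_mul[of "A ** P"] P(2))
      also have "A ** P ** (A ** B) = A ** B"
        by (simp add: matrix_mul_assoc P(1))
      finally show ?thesis .
    qed
    have "(transpose (A ** H ** A) + H ** A ** P) ** (A ** P)
        = (transpose A + H) ** (A ** P)"
      by (simp add: eq)
    moreover have "transpose (A ** H ** A) ** (A ** P) = transpose (A ** H ** A)"
      using absorb[of "H ** A"] by (simp only: matrix_mul_assoc)
    moreover have "transpose A ** (A ** P) = transpose A"
      using absorb[of "mat 1"] by simp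
    moreover have "H ** A ** P ** (A ** P) = H ** A ** P"
      by (metis P(1) matrix_mul_assoc)
    ultimately have "transpose (A ** H ** A) + H ** A ** P = transpose A + H ** A ** P"
      by (simp only: matrix_add_rdistrib) (simp add: matrix_mul_assoc)
    then have AHA: "A ** H ** A = A"
      by (metis add_right_cancel transpose_transpose)
    with eq have HAP: "H ** A ** P = H" by simp
    then have AH: "A ** H = A ** P"
      using AHA by (metis matrix_mul_assoc)
    then have "H ** A ** H = H"
      using HAP by (metis matrix_mul_assoc)
    then show "generalized_inverse A H \<and> reflexive_inverse A H \<and> ah_symmetric A H"
      using AHA AH P(2)
      by (simp add: generalized_inverse_def reflexive_inverse_def ah_symmetric_def)
  qed
qed

end
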